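(* Let $\mathcal{A}_1,\mathcal{A}_2$ (agents) and $\mathcal{B}_1,\mathcal{B}_2$ (tasks) be pairwise disjoint finite nonempty sets with $|\mathcal{A}_1|=m_1\ge n_1=|\mathcal{B}_1|$ and $|\mathcal{A}_2|=m_2\ge n_2=|\mathcal{B}_2|$. Put $\mathcal{A}_3=\mathcal{A}_1\cup\mathcal{A}_2$, $\mathcal{B}_3=\mathcal{B}_1\cup\mathcal{B}_2$, and for $k=1,2,3$ let $\mathcal{G}_k$ be the complete bipartite graph with vertex set $\mathcal{V}_k=\mathcal{A}_k\cup\mathcal{B}_k$ and edge set $\mathcal{E}_k=\{\{i,j\}\mid i\in\mathcal{A}_k,\ j\in\mathcal{B}_k\}$. Let $w:\mathcal{E}_3\to\mathbb{R}$ be a weight function (restricted to $\mathcal{E}_1,\mathcal{E}_2\subseteq\mathcal{E}_3$ where needed). For $k=1,2$ let $\mathcal{M}_k$ be a solution to $BOT(\mathcal{G}_k)$ and let $e_k\in\arg\max_{e\in\mathcal{M}_k}w(e)$. Let $e_3$ be a bottleneck edge of $\mathcal{G}_3$. Then $$w(e_3)\le\max\{w(e_1),w(e_2)\}.$$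
   Context: A matching in a graph is a set of edges such that no vertex is incident with more than one of them; a maximum cardinality matching (MCM) is a matching of maximum cardinality. For a complete bipartite graph $\mathcal{G}$ with real edge weights $w$, let $\mathcal{C}(\mathcal{G})$ be the set of all MCMs of $\mathcal{G}$. The bottleneck assignment problem is $$BOT(\mathcal{G}):\quad \min_{\mathcal{M}\in\mathcal{C}(\mathcal{G})}\ \max_{e\in\mathcal{M}} w(e),$$ and a solution to $BOT(\mathcal{G})$ is an MCM $\mathcal{M}$ attaining this minimum. A bottleneck edge of $\mathcal{G}$ is any edge $e\in\arg\max_{e'\in\mathcal{M}}w(e')$ where $\mathcal{M}$ is any solution to $BOT(\mathcal{G})$. *)

theory Defs
  imports Complex_Main
begin

text \<open>A simple graph is a pair of a vertex set and a set of (two-element) edges. Weights are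
  total functions on sets of vertices; only their values on edges are ever used.\<close>

type_synonym 'v graph = "'v set \<times> 'v set set"

abbreviation verts :: "'v graph \<Rightarrow> 'v set" where
  "verts G \<equiv> fst G"

abbreviation edges :: "'v graph \<Rightarrow> 'v set set" where
  "edges G \<equiv> snd G"

definition complete_bipartite :: "'v set \<Rightarrow> 'v set \<Rightarrow> 'v graph" where
  "complete_bipartite A B = (A \<union> B, {{i, j} | i j. i \<in> A \<and> j \<in> B})"

definition matching :: "'v graph \<Rightarrow> 'v set set \<Rightarrow> bool" where
  "matching G M \<longleftrightarrow> M \<subseteq> edges G \<and>
     (\<forall>v\<in>verts G. \<forall>e\<in>M. \<forall>f\<in>M. v \<in> e \<longrightarrow> v \<in> f \<longrightarrow> e = f)"

text \<open>As \<open>card\<close> of an infinite set is 0, the next notion is meaningful for finite graphs only.\<close>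

definition max_matchings :: "'v graph \<Rightarrow> 'v set set set" where
  "max_matchings G = {M. matching G M \<and> (\<forall>N. matching G N \<longrightarrow> card N \<le> card M)}"

text \<open>\<open>Min\<close> and \<open>Max\<close> below are attained, since a finite graph with at least one edge has
  finitely many maximum cardinality matchings, each of them finite and nonempty.\<close>

definition bot_value :: "'v graph \<Rightarrow> ('v set \<Rightarrow> real) \<Rightarrow> real" where
  "bot_value G w = (MIN M\<in>max_matchings G. MAX e\<in>M. w e)"

definition bot_solution :: "'v graph \<Rightarrow> ('v set \<Rightarrow> real) \<Rightarrow> 'v set set \<Rightarrow> bool" where
  "bot_solution G w M \<longleftrightarrow> M \<in> max_matchings G \<and> (MAX e\<in>M. w e) = bot_value G w"

definition bottleneck_edge :: "'v graph \<Rightarrow> ('v set \<Rightarrow> real) \<Rightarrow> 'v set \<Rightarrow> bool" where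
  "bottleneck_edge G w e \<longleftrightarrow> (\<exists>M. bot_solution G w M \<and> is_arg_max w (\<lambda>e'. e' \<in> M) e)"

end

theory Submission
  imports Defs
begin

text \<open>Since the agents outnumber the tasks, the maximum matchings are exactly those covering every
  task. Hence \<open>M1 \<union> M2\<close> is a maximum matching of the joint graph, and its largest weight bounds
  the bottleneck value from above.\<close>

lemma edges_complete_bipartite:
  "edges (complete_bipartite A B) = (\<lambda>(i, j). {i, j}) ` (A \<times> B)"
  by (auto simp: complete_bipartite_def)

lemma verts_complete_bipartite: "verts (complete_bipartite A B) = A \<union> B"
  by (simp add: complete_bipartite_def)

lemma finite_edges_complete_bipartite:
  "finite A \<Longrightarrow> finite B \<Longrightarrow> finite (edges (complete_bipartite A B))"
  by (simp add: edges_complete_bipartite)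

lemma edge_complete_bipartite:
  assumes "e \<in> edges (complete_bipartite A B)"
  shows "e \<subseteq> A \<union> B" and "e \<noteq> {}"
  using assms by (auto simp: edges_complete_bipartite)

lemma matching_subset_edges: "matching G M \<Longrightarrow> M \<subseteq> edges G"
  by (simp add: matching_def)

lemma max_matching_matching: "M \<in> max_matchings G \<Longrightarrow> matching G M"
  by (simp add: max_matchings_def)

lemma finite_max_matching: "finite (edges G) \<Longrightarrow> M \<in> max_matchings G \<Longrightarrow> finite M"
  using finite_subset[OF matching_subset_edges[OF max_matching_matching]] by blast

lemma matching_unique:
  "matching G M \<Longrightarrow> v \<in> verts G \<Longrightarrow> e \<in> M \<Longrightarrow> f \<in> M \<Longrightarrow> v \<in> e \<Longrightarrow> v \<in> f \<Longrightarrow> e = f"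
  unfolding matching_def by blast

lemma finite_max_matchings:
  assumes "finite (edges G)"
  shows "finite (max_matchings G)"
proof (rule finite_subset)
  show "max_matchings G \<subseteq> Pow (edges G)"
    by (auto simp: max_matchings_def matching_def)
qed (use assms in simp)

text \<open>Every edge contains a vertex of \<open>B\<close>. Choosing one such vertex for each edge
  of \<open>M\<close> gives an injection of \<open>M\<close> into \<open>B\<close>, because two
  edges of a matching with a common vertex coincide.\<close>

lemma card_matching_complete_bipartite_le:
  assumes "matching (complete_bipartite A B) M" and "finite B"
  shows "card M \<le> card B"
proof -
  have "\<forall>e\<in>M. \<exists>b\<in>B. b \<in> e"
    using matching_subset_edges[OF assms(1)] unfolding edges_complete_bipartite by blast
  then obtain f where f: "\<And>e. e \<in> M \<Longrightarrow> f e \<in> B \<and> f e \<in> e"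
    by metis
  have "inj_on f M"
  proof (rule inj_onI)
    fix e e'
    assume "e \<in> M" "e' \<in> M" "f e = f e'"
    then show "e = e'"
      using f[of e] f[of e'] matching_unique[OF assms(1), of "f e" e e']
      by (simp add: verts_complete_bipartite)
  qed
  then show ?thesis
    using f assms(2) by (intro card_inj_on_le[of f]) auto
qed

text \<open>An injection \<open>f\<close> of \<open>B\<close> into \<open>A\<close> exists by
  cardinality, and pairing each task \<open>b\<close> with \<open>f b\<close> yields the
  matching.\<close>

lemma ex_matching_complete_bipartite:
  assumes "finite A" "finite B" "A \<inter> B = {}" "card B \<le> card A"
  obtains M where "matching (complete_bipartite A B) M" "card M = card B"
proof -
  obtain f where f: "f ` B \<subseteq> A" "inj_on f B"
    using card_le_inj[OF assms(2,1,4)] by blast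
  let ?M = "(\<lambda>b. {f b, b}) ` B"
  \<comment> \<open>Equal doubletons could also agree crosswise, with \<open>f b = b'\<close>. This
    is impossible because \<open>f b\<close> lies in \<open>A\<close> and \<open>b'\<close> in
    \<open>B\<close>.\<close>
  have "inj_on (\<lambda>b. {f b, b}) B"
    using f(1) assms(3) by (auto simp: inj_on_def doubleton_eq_iff)
  then have "card ?M = card B"
    by (rule card_image)
  moreover have "matching (complete_bipartite A B) ?M"
    unfolding matching_def
  proof (intro conjI ballI impI)
    show "?M \<subseteq> edges (complete_bipartite A B)"
      using f(1) by (auto simp: edges_complete_bipartite)
  next
    fix v e e'
    assume "e \<in> ?M" "e' \<in> ?M" "v \<in> e" "v \<in> e'"
    then obtain b b' where b: "b \<in> B" "b' \<in> B" "e = {f b, b}" "e' = {f b', b'}"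
      and "v = f b \<or> v = b" "v = f b' \<or> v = b'"
      by auto
    moreover have "f b \<in> A" "f b' \<in> A"
      using b f(1) by auto
    \<comment> \<open>A shared vertex is an agent of both edges or a task of both, since
      \<open>A\<close> and \<open>B\<close> are disjoint. The first case is settled by injectivity
      of \<open>f\<close>, the second is immediate.\<close>
    ultimately have "b = b'"
      using assms(3) f(2) by (auto dest: inj_onD)
    then show "e = e'"
      using b by simp
  qed
  ultimately show ?thesis
    using that by blast
qed

text \<open>The general upper bound \<open>card B\<close> is attained by an explicit matching, so a
  matching of maximum size has exactly this size.\<close>

lemma card_max_matching_complete_bipartite:
  assumes "finite A" "finite B" "A \<inter> B = {}" "card B \<le> card A"
    and "M \<in> max_matchings (complete_bipartite A B)"
  shows "card M = card B"
proof (rule antisym)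
  show "card M \<le> card B"
    using assms card_matching_complete_bipartite_le by (auto simp: max_matchings_def)
  show "card B \<le> card M"
    using assms(5) ex_matching_complete_bipartite[OF assms(1-4)]
    by (metis (mono_tags, lifting) max_matchings_def mem_Collect_eq)
qed

lemma matching_Un_complete_bipartite:
  assumes M1: "matching (complete_bipartite A1 B1) M1"
    and M2: "matching (complete_bipartite A2 B2) M2"
    and disj: "(A1 \<union> B1) \<inter> (A2 \<union> B2) = {}"
  shows "matching (complete_bipartite (A1 \<union> A2) (B1 \<union> B2)) (M1 \<union> M2)"
  unfolding matching_def
proof (intro conjI ballI impI)
  show "M1 \<union> M2 \<subseteq> edges (complete_bipartite (A1 \<union> A2) (B1 \<union> B2))"
    using M1 M2 unfolding matching_def edges_complete_bipartite by blast
next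
  fix v e f
  assume *: "e \<in> M1 \<union> M2" "f \<in> M1 \<union> M2" "v \<in> e" "v \<in> f"
  have "v \<in> A1 \<union> B1" if "v \<in> e" "e \<in> M1" for e
    using edge_complete_bipartite(1)[OF subsetD[OF matching_subset_edges[OF M1]]] that by blast
  moreover have "v \<in> A2 \<union> B2" if "v \<in> e" "e \<in> M2" for e
    using edge_complete_bipartite(1)[OF subsetD[OF matching_subset_edges[OF M2]]] that by blast
  \<comment> \<open>The two vertex sets are disjoint, so a common vertex puts both edges into the
    same \<open>Mi\<close>. The matching property of that \<open>Mi\<close> then applies.\<close>
  ultimately have "v \<in> A1 \<union> B1 \<and> e \<in> M1 \<and> f \<in> M1 \<or> v \<in> A2 \<union> B2 \<and> e \<in> M2 \<and> f \<in> M2"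
    using * disj by blast
  then show "e = f"
    using *(3,4) matching_unique[OF M1, of v e f] matching_unique[OF M2, of v e f]
    unfolding verts_complete_bipartite by blast
qed

text \<open>Maximality is a count: the sizes of \<open>M1\<close> and \<open>M2\<close> add up to
  \<open>card (B1 \<union> B2)\<close>, which bounds the size of every matching of the joint
  graph.\<close>

lemma max_matching_Un_complete_bipartite:
  assumes "finite A1" "finite A2" "finite B1" "finite B2"
    and "A1 \<inter> A2 = {}" "A1 \<inter> B1 = {}" "A1 \<inter> B2 = {}"
    and "A2 \<inter> B1 = {}" "A2 \<inter> B2 = {}" "B1 \<inter> B2 = {}"
    and "card B1 \<le> card A1" "card B2 \<le> card A2"
    and "M1 \<in> max_matchings (complete_bipartite A1 B1)"
    and "M2 \<in> max_matchings (complete_bipartite A2 B2)"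
  shows "M1 \<union> M2 \<in> max_matchings (complete_bipartite (A1 \<union> A2) (B1 \<union> B2))"
proof -
  have M: "matching (complete_bipartite A1 B1) M1" "matching (complete_bipartite A2 B2) M2"
    using assms by (auto simp: max_matchings_def)
  have match: "matching (complete_bipartite (A1 \<union> A2) (B1 \<union> B2)) (M1 \<union> M2)"
    using M by (rule matching_Un_complete_bipartite) (use assms(5-10) in blast)
  have sub: "M1 \<subseteq> edges (complete_bipartite A1 B1)" "M2 \<subseteq> edges (complete_bipartite A2 B2)"
    using M by (auto simp: matching_def)
  have "finite M1" "finite M2"
    using assms(1-4,13,14) finite_max_matching finite_edges_complete_bipartite by blast+
  moreover have "M1 \<inter> M2 = {}"
  proof (rule equals0I)
    fix e
    assume "e \<in> M1 \<inter> M2"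
    then have e: "e \<in> edges (complete_bipartite A1 B1)" "e \<in> edges (complete_bipartite A2 B2)"
      using sub by auto
    \<comment> \<open>A common edge would be a nonempty set contained in two disjoint vertex
      sets.\<close>
    show False
      using edge_complete_bipartite(1)[OF e(1)] edge_complete_bipartite[OF e(2)] assms(5-10)
      by blast
  qed
  ultimately have "card (M1 \<union> M2) = card M1 + card M2"
    by (rule card_Un_disjoint)
  also have "\<dots> = card (B1 \<union> B2)"
    using assms card_max_matching_complete_bipartite[of A1 B1 M1]
      card_max_matching_complete_bipartite[of A2 B2 M2]
    by (simp add: card_Un_disjoint)
  finally have "card (M1 \<union> M2) = card (B1 \<union> B2)" .
  then show ?thesis
    using match assms(3,4) card_matching_complete_bipartite_le[of "A1 \<union> A2" "B1 \<union> B2"]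
    by (simp add: max_matchings_def)
qed

lemma bot_value_le:
  assumes "finite (edges G)" "M \<in> max_matchings G"
  shows "bot_value G w \<le> (MAX e\<in>M. w e)"
  unfolding bot_value_def using assms by (intro Min_le) (auto simp: finite_max_matchings)

lemma is_arg_max_Max:
  fixes w :: "'a \<Rightarrow> 'b :: linorder"
  assumes "finite M" "is_arg_max w (\<lambda>e. e \<in> M) e"
  shows "w e = (MAX e\<in>M. w e)"
  using assms by (intro Max_eqI[symmetric]) (auto simp: is_arg_max_linorder)

text \<open>All solutions share the same largest weight, so the weight of a bottleneck edge does not
  depend on the solution it is taken from. Thus \<open>e3\<close> can be compared with
  \<open>M1 \<union> M2\<close> although it may come from an unrelated matching.\<close>

lemma bottleneck_edge_weight:
  assumes "finite (edges G)" "bottleneck_edge G w e"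
  shows "w e = bot_value G w"
proof -
  obtain M where M: "bot_solution G w M" "is_arg_max w (\<lambda>e. e \<in> M) e"
    using assms(2) by (auto simp: bottleneck_edge_def)
  then have "finite M"
    using assms(1) by (auto simp: bot_solution_def finite_max_matching)
  then show ?thesis
    using M is_arg_max_Max by (metis bot_solution_def)
qed

theorem theorem1:
  fixes A1 A2 B1 B2 :: "'v set" and m1 m2 n1 n2 :: nat
    and w :: "'v set \<Rightarrow> real"
    and M1 M2 :: "'v set set" and e1 e2 e3 :: "'v set"
  assumes "finite A1" "finite A2" "finite B1" "finite B2"
    and "A1 \<noteq> {}" "A2 \<noteq> {}" "B1 \<noteq> {}" "B2 \<noteq> {}"
    and "A1 \<inter> A2 = {}" "A1 \<inter> B1 = {}" "A1 \<inter> B2 = {}"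
    and "A2 \<inter> B1 = {}" "A2 \<inter> B2 = {}" "B1 \<inter> B2 = {}"
    and "card A1 = m1" "card B1 = n1" "m1 \<ge> n1"
    and "card A2 = m2" "card B2 = n2" "m2 \<ge> n2"
    and "bot_solution (complete_bipartite A1 B1) w M1"
    and "is_arg_max w (\<lambda>e. e \<in> M1) e1"
    and "bot_solution (complete_bipartite A2 B2) w M2"
    and "is_arg_max w (\<lambda>e. e \<in> M2) e2"
    and "bottleneck_edge (complete_bipartite (A1 \<union> A2) (B1 \<union> B2)) w e3"
  shows "w e3 \<le> max (w e1) (w e2)"
proof -
  let ?G = "complete_bipartite (A1 \<union> A2) (B1 \<union> B2)"
  have fin: "finite (edges ?G)"
    using assms by (simp add: finite_edges_complete_bipartite)
  have M: "M1 \<union> M2 \<in> max_matchings ?G"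
    by (rule max_matching_Un_complete_bipartite) (use assms in \<open>simp_all add: bot_solution_def\<close>)
  have "finite (M1 \<union> M2)"
    using fin M by (rule finite_max_matching)
  \<comment> \<open>This shows that the union is nonempty, which \<open>Max_le_iff\<close> requires
    along with finiteness.\<close>
  moreover have "e1 \<in> M1 \<union> M2"
    using assms(22) by (simp add: is_arg_max_def)
  moreover have "\<forall>e\<in>M1 \<union> M2. w e \<le> max (w e1) (w e2)"
    using assms(22,24) unfolding is_arg_max_linorder le_max_iff_disj by blast
  ultimately have "(MAX e\<in>M1 \<union> M2. w e) \<le> max (w e1) (w e2)"
    by (subst Max_le_iff) auto
  \<comment> \<open>The chain is: \<open>w e3\<close> equals the bottleneck value, which is at most
    the largest weight in the competitor \<open>M1 \<union> M2\<close>, which has just been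
    bounded.\<close>
  then show ?thesis
    using bottleneck_edge_weight[OF fin, of w e3] bot_value_le[OF fin M, of w] assms(25) by linarith
qed

end
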